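(* For any two full binary trees $T_1$ and $T_2$, each with $n$ internal nodes, of rank $r_1$ and $r_2$ respectively, we have $d_R(T_1,T_2)\le n^2\bigl(1+(2n+1)(r_1+r_2-2)\bigr)$.
   Context: A full binary tree is a rooted ordered tree in which every node is either a leaf or an internal node with exactly two children. A right rotation at an internal node $a$ whose left child $b$ is internal, where $C,D$ are the left and right subtrees of $b$ and $E$ is the right subtree of $a$, replaces the subtree rooted at $a$ by the tree with root $b$, left subtree $C$, and right child $a$ whose left and right subtrees are $D$ and $E$; a left rotation is the symmetric (inverse) operation. The rank of a node is defined inductively: a leaf has rank $0$; an internal node with children $v,w$ has rank $\mathrm{rank}(v)+1$ if $\mathrm{rank}(v)=\mathrm{rank}(w)$, and $\max\{\mathrm{rank}(v),\mathrm{rank}(w)\}$ otherwise; the rank of a tree is the rank of its root. For $T_1,T_2$ with the same number of internal nodes, let $r=\max\{\mathrm{rank}(T_1),\mathrm{rank}(T_2)\}$; $d_R(T_1,T_2)$ is the minimum length of a sequence of rotations transforming $T_1$ into $T_2$ such that every intermediate tree has rank at most $r$. *)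

theory Defs
  imports "HOL-Library.Tree" "HOL-Library.Extended_Real"
begin

text \<open>A full binary tree carries no data, so internal nodes are labelled by the unit value;
  \<^term>\<open>size t\<close> is the number of internal nodes of \<^term>\<open>t\<close>.\<close>

type_synonym full_btree = "unit tree"

fun rank :: "full_btree \<Rightarrow> nat" where
  "rank Leaf = 0"
| "rank (Node l _ r) = (if rank l = rank r then rank l + 1 else max (rank l) (rank r))"

text \<open>The last two rules allow the rotation to take place at any internal node.\<close>

inductive right_rotation :: "full_btree \<Rightarrow> full_btree \<Rightarrow> bool" where
  root: "right_rotation (Node (Node C () D) () E) (Node C () (Node D () E))"
| in_left: "right_rotation l l' \<Longrightarrow> right_rotation (Node l () r) (Node l' () r)"
| in_right: "right_rotation r r' \<Longrightarrow> right_rotation (Node l () r) (Node l () r')"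

definition left_rotation :: "full_btree \<Rightarrow> full_btree \<Rightarrow> bool" where
  "left_rotation t t' \<longleftrightarrow> right_rotation t' t"

definition rotation :: "full_btree \<Rightarrow> full_btree \<Rightarrow> bool" where
  "rotation t t' \<longleftrightarrow> right_rotation t t' \<or> left_rotation t t'"

text \<open>\<open>ts\<close> lists all the trees visited, including both end points, so a sequence of
  \<open>k\<close> rotations has \<open>k + 1\<close> entries.\<close>

definition rotation_sequence :: "nat \<Rightarrow> full_btree \<Rightarrow> full_btree \<Rightarrow> full_btree list \<Rightarrow> bool" where
  "rotation_sequence r T1 T2 ts \<longleftrightarrow>
     ts \<noteq> [] \<and> hd ts = T1 \<and> last ts = T2 \<and> successively rotation ts \<and>
     (\<forall>t\<in>set ts. rank t \<le> r)"

text \<open>The infimum is taken in \<^typ>\<open>enat\<close>: it is attained whenever some admissible sequence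
  exists, and it is infinite otherwise, so a finite upper bound entails existence.\<close>

definition d_R :: "full_btree \<Rightarrow> full_btree \<Rightarrow> enat" where
  "d_R T1 T2 =
     Inf {enat k | k. \<exists>ts. rotation_sequence (max (rank T1) (rank T2)) T1 T2 ts \<and> length ts = k + 1}"

end

theory Submission
  imports Defs
begin

text \<open>Both trees are brought to the right comb without exceeding their own rank.  Since the rank
  is monotone in the subtrees, one may first turn the two subtrees of the root recursively into
  right combs.  The two combs are then merged by right rotations along the right spine; all trees
  visited have rank at most 2, and rank at most 1 if the right comb is a leaf, which suffices
  because a tree of rank at most 1 has a leaf below its root.  The recursion needs at most
  \<open>n\<^sup>2 / 2\<close> rotations, so in fact \<open>d_R T1 T2 \<le> n\<^sup>2\<close>.\<close>

text \<open>Bounding both end points makes the relation symmetric, so paths can be reversed, and its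
  power \<open>^^ k\<close> counts rotations.\<close>

definition bounded_rotation :: "nat \<Rightarrow> full_btree \<Rightarrow> full_btree \<Rightarrow> bool" where
  "bounded_rotation m t t' \<longleftrightarrow> rotation t t' \<and> rank t \<le> m \<and> rank t' \<le> m"

lemma bounded_rotation_sym: "bounded_rotation m t t' \<Longrightarrow> bounded_rotation m t' t"
  by (auto simp: bounded_rotation_def rotation_def left_rotation_def)

lemma bounded_rotation_mono: "bounded_rotation m t t' \<Longrightarrow> m \<le> m' \<Longrightarrow> bounded_rotation m' t t'"
  by (auto simp: bounded_rotation_def)

lemma rotation_in_left: "rotation l l' \<Longrightarrow> rotation (Node l () r) (Node l' () r)"
  by (auto simp: rotation_def left_rotation_def intro: right_rotation.in_left)

lemma rotation_in_right: "rotation r r' \<Longrightarrow> rotation (Node l () r) (Node l () r')"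
  by (auto simp: rotation_def left_rotation_def intro: right_rotation.in_right)

text \<open>If the smaller ranks tie at the maximum of the larger ones, the larger ones tie as well;
  any other tie is strictly below that maximum, which absorbs the increment.\<close>

lemma rank_Node_mono:
  "rank l' \<le> rank l \<Longrightarrow> rank r' \<le> rank r \<Longrightarrow> rank (Node l' () r') \<le> rank (Node l () r)"
  by auto

lemma relpowp_map:
  assumes "(P ^^ k) x y" and "\<And>u v. P u v \<Longrightarrow> Q (f u) (f v)"
  shows "(Q ^^ k) (f x) (f y)"
  using assms(1) by (induction k arbitrary: y) (auto intro: assms(2))

lemma relpowp_sym:
  assumes "(P ^^ k) x y" and "\<And>u v. P u v \<Longrightarrow> P v u"
  shows "(P ^^ k) y x"
  using assms(1) by (induction k arbitrary: y) (auto simp del: relpowp.simps(2) elim!: relpowp_Suc_E intro: assms(2) relpowp_Suc_I2)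

lemma bounded_rotations_mono:
  "(bounded_rotation m ^^ k) t t' \<Longrightarrow> m \<le> m' \<Longrightarrow> (bounded_rotation m' ^^ k) t t'"
  by (erule relpowp_map[where f = "\<lambda>t. t"]) (auto intro: bounded_rotation_mono)

lemma bounded_rotations_in_left:
  assumes "(bounded_rotation m ^^ k) l l'"
    and "\<And>x. rank x \<le> m \<Longrightarrow> rank (Node x () r) \<le> m'"
  shows "(bounded_rotation m' ^^ k) (Node l () r) (Node l' () r)"
  using assms(1) by (rule relpowp_map[where f = "\<lambda>x. Node x () r"])
    (use assms(2) in \<open>auto simp: bounded_rotation_def simp del: rank.simps intro: rotation_in_left\<close>)

lemma bounded_rotations_in_right:
  assumes "(bounded_rotation m ^^ k) r r'"
    and "\<And>x. rank x \<le> m \<Longrightarrow> rank (Node l () x) \<le> m'"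
  shows "(bounded_rotation m' ^^ k) (Node l () r) (Node l () r')"
  using assms(1) by (rule relpowp_map[where f = "\<lambda>x. Node l () x"])
    (use assms(2) in \<open>auto simp: bounded_rotation_def simp del: rank.simps intro: rotation_in_right\<close>)

fun right_comb :: "nat \<Rightarrow> full_btree" where
  "right_comb 0 = Leaf"
| "right_comb (Suc n) = Node Leaf () (right_comb n)"

lemma rank_right_comb: "rank (right_comb n) = (if n = 0 then 0 else 1)"
  by (induction n) auto

lemma rank_eq_0_iff: "rank t = 0 \<longleftrightarrow> t = Leaf"
  by (induction t) auto

text \<open>A comb has rank at most 1, and only a leaf has rank 0, so the comb has the least rank
  among trees of its size.\<close>

lemma rank_right_comb_le: "rank (right_comb (size t)) \<le> rank t"
  using rank_eq_0_iff[of t] by (auto simp: rank_right_comb)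

text \<open>A right rotation at the root passes the first leaf of the left comb to the right spine
  and leaves the same problem, with a shorter left comb, in the right subtree. Two nonempty combs
  side by side have rank 2, hence the alternative for \<open>b\<close>.\<close>

lemma merge_right_combs:
  assumes "m \<ge> 1" and "b = 0 \<or> m \<ge> 2"
  shows "(bounded_rotation m ^^ a) (Node (right_comb a) () (right_comb b)) (right_comb (Suc (a + b)))"
proof (induction a)
  case 0
  show ?case by simp
next
  case (Suc a)
  have "bounded_rotation m (Node (right_comb (Suc a)) () (right_comb b))
      (Node Leaf () (Node (right_comb a) () (right_comb b)))"
    using assms
    by (auto simp: bounded_rotation_def rotation_def rank_right_comb intro: right_rotation.root)
  moreover have "(bounded_rotation m ^^ a) (Node Leaf () (Node (right_comb a) () (right_comb b)))
      (Node Leaf () (right_comb (Suc (a + b))))"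
    \<comment> \<open>A leaf sibling raises the rank only of another leaf, and then to 1, which
      \<open>m\<close> allows.\<close>
    using Suc.IH by (rule bounded_rotations_in_right) (use assms in auto)
  ultimately show ?case
    using relpowp_Suc_I2 by fastforce
qed

text \<open>With subtree sizes \<open>a\<close> and \<open>b\<close>, the merge costs at most
  \<open>a\<close> rotations, and a^2 + b^2 + 2a \<le> (a + b + 1)^2 closes the induction.\<close>

lemma bounded_rotations_to_right_comb:
  "\<exists>k. 2 * k \<le> (size t)\<^sup>2 \<and> (bounded_rotation (rank t) ^^ k) t (right_comb (size t))"
proof (induction t)
  case Leaf
  show ?case by (auto intro: exI[of _ 0])
next
  case (Node l u r)
  let ?t = "Node l () r" and ?a = "size l" and ?b = "size r"
  obtain k1 where k1: "2 * k1 \<le> ?a\<^sup>2" "(bounded_rotation (rank l) ^^ k1) l (right_comb ?a)"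
    using Node.IH(1) by blast
  obtain k2 where k2: "2 * k2 \<le> ?b\<^sup>2" "(bounded_rotation (rank r) ^^ k2) r (right_comb ?b)"
    using Node.IH(2) by blast
  have 1: "(bounded_rotation (rank ?t) ^^ k1) ?t (Node (right_comb ?a) () r)"
    using k1(2) by (rule bounded_rotations_in_left) (rule rank_Node_mono, auto)
  have 2: "(bounded_rotation (rank ?t) ^^ k2)
      (Node (right_comb ?a) () r) (Node (right_comb ?a) () (right_comb ?b))"
    using k2(2) by (rule bounded_rotations_in_right) (intro rank_Node_mono rank_right_comb_le)
  have "\<exists>k\<le>?a. (bounded_rotation (rank ?t) ^^ k)
      (Node (right_comb ?a) () (right_comb ?b)) (right_comb (Suc (?a + ?b)))"
  \<comment> \<open>A leaf on the left already gives a comb; here the rank may be 1 although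
    \<open>r\<close> is internal, so the merge lemma could not be applied. If both subtrees are
    internal, a tie at 1 or a larger maximum yields rank at least 2.\<close>
  proof (cases "l = Leaf")
    case True
    then show ?thesis by (auto intro: exI[of _ 0])
  next
    case False
    then have "rank ?t \<ge> 1" "?b = 0 \<or> rank ?t \<ge> 2"
      using rank_eq_0_iff[of l] rank_eq_0_iff[of r] by auto
    then show ?thesis using merge_right_combs by blast
  qed
  then obtain k3 where k3: "k3 \<le> ?a" "(bounded_rotation (rank ?t) ^^ k3)
      (Node (right_comb ?a) () (right_comb ?b)) (right_comb (size ?t))"
    by auto
  have "(bounded_rotation (rank ?t) ^^ (k1 + k2 + k3)) ?t (right_comb (size ?t))"
    using 1 2 k3(2) by (auto simp: relpowp_add simp del: rank.simps)
  moreover have "2 * (k1 + k2 + k3) \<le> (size ?t)\<^sup>2"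
    using k1(1) k2(1) k3(1) by (simp add: power2_eq_square algebra_simps)
  ultimately have "\<exists>k. 2 * k \<le> (size ?t)\<^sup>2 \<and> (bounded_rotation (rank ?t) ^^ k) ?t (right_comb (size ?t))"
    by blast
  then show ?case by simp
qed

text \<open>The bound on \<open>rank t\<close> matters for \<open>k = 0\<close>, where no rotation
  supplies it.\<close>

lemma rotation_sequence_if_bounded_rotations:
  assumes "(bounded_rotation m ^^ k) t t'" and "rank t \<le> m"
  shows "\<exists>ts. rotation_sequence m t t' ts \<and> length ts = k + 1"
  using assms
proof (induction k arbitrary: t)
  case 0
  then show ?case by (auto intro!: exI[of _ "[t]"] simp: rotation_sequence_def)
next
  case (Suc k)
  then obtain s where s: "bounded_rotation m t s" "(bounded_rotation m ^^ k) s t'"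
    by (meson relpowp_Suc_D2)
  from s(1) have "rank s \<le> m"
    by (simp add: bounded_rotation_def)
  with Suc.IH[OF s(2)] obtain ts where ts: "rotation_sequence m s t' ts" "length ts = k + 1"
    by blast
  with s(1) Suc.prems show ?case
    by (intro exI[of _ "t # ts"])
      (auto simp: rotation_sequence_def bounded_rotation_def successively_Cons)
qed

text \<open>The path from \<open>T1\<close> to the comb is followed by the reversed path from
  \<open>T2\<close>; each takes at most half of n^2 rotations.\<close>

lemma d_R_le_size_squared:
  assumes "size T1 = n" and "size T2 = n"
  shows "d_R T1 T2 \<le> enat (n\<^sup>2)"
proof -
  let ?m = "max (rank T1) (rank T2)"
  obtain k1 where k1: "2 * k1 \<le> n\<^sup>2" "(bounded_rotation (rank T1) ^^ k1) T1 (right_comb n)"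
    using bounded_rotations_to_right_comb[of T1] unfolding assms by blast
  obtain k2 where k2: "2 * k2 \<le> n\<^sup>2" "(bounded_rotation (rank T2) ^^ k2) T2 (right_comb n)"
    using bounded_rotations_to_right_comb[of T2] unfolding assms by blast
  have "(bounded_rotation ?m ^^ k1) T1 (right_comb n)"
    using k1(2) by (rule bounded_rotations_mono) simp
  moreover have "(bounded_rotation ?m ^^ k2) (right_comb n) T2"
    using k2(2) by (rule relpowp_sym[OF bounded_rotations_mono]) (simp, rule bounded_rotation_sym)
  ultimately have "(bounded_rotation ?m ^^ (k1 + k2)) T1 T2"
    by (auto simp: relpowp_add)
  then have "\<exists>ts. rotation_sequence ?m T1 T2 ts \<and> length ts = k1 + k2 + 1"
    by (rule rotation_sequence_if_bounded_rotations) simp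
  then have "d_R T1 T2 \<le> enat (k1 + k2)"
    unfolding d_R_def by (intro Inf_lower) blast
  also have "\<dots> \<le> enat (n\<^sup>2)"
    using k1(1) k2(1) by simp
  finally show ?thesis .
qed

theorem theorem3:
  fixes T1 T2 :: full_btree and n r1 r2 :: nat
  assumes "size T1 = n" and "size T2 = n"
    and "rank T1 = r1" and "rank T2 = r2"
  shows "ereal_of_enat (d_R T1 T2) \<le>
    ereal ((real n)\<^sup>2 * (1 + (2 * real n + 1) * (real r1 + real r2 - 2)))"
proof -
  have "ereal_of_enat (d_R T1 T2) \<le> ereal_of_enat (enat (n\<^sup>2))"
    using d_R_le_size_squared[OF assms(1,2)] by (simp only: ereal_of_enat_le_iff)
  also have "\<dots> = ereal ((real n)\<^sup>2)"
    by simp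
  also have "\<dots> \<le> ereal ((real n)\<^sup>2 * (1 + (2 * real n + 1) * (real r1 + real r2 - 2)))"
  \<comment> \<open>For \<open>n = 0\<close> the factor \<open>real r1 + real r2 - 2\<close> is
    negative, but it is multiplied by 0; otherwise both ranks are at least 1.\<close>
  proof (cases "n = 0")
    case False
    then have "r1 \<noteq> 0" "r2 \<noteq> 0"
      using assms rank_eq_0_iff[of T1] rank_eq_0_iff[of T2] by auto
    then have "0 \<le> (2 * real n + 1) * (real r1 + real r2 - 2)"
      by (intro mult_nonneg_nonneg) auto
    then have "(real n)\<^sup>2 * 1 \<le> (real n)\<^sup>2 * (1 + (2 * real n + 1) * (real r1 + real r2 - 2))"
      by (intro mult_left_mono) auto
    then show ?thesis by simp
  qed simp
  finally show ?thesis .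
qed

end
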